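(* Let $P:(-1,\infty)\to\mathbb{R}$ be twice continuously differentiable with $P(0)=0$, $P'(0)>0$ and $P''(0)<0$. Then for each entropy/entropy-flux pair $(\Phi,\Psi)$ for the p-system $V_t-(P(\Gamma))_X=0$, $\Gamma_t-V_X=0$ with $\Phi$ strictly convex, there exists $\delta>0$ such that for every $\Gamma_l\in(-\delta,0]$ the compression shock $S(\Gamma_l)$ satisfies the entropy condition corresponding to $(\Phi,\Psi)$.
   Context: Entropy/entropy-flux pair: a pair of real-valued $C^2$ functions $\Phi(V,\Gamma),\Psi(V,\Gamma)$ on $\mathbb{R}\times(-1,\infty)$, with $\Phi$ convex, such that $\Psi_V=-\Phi_\Gamma$ and $\Psi_\Gamma=-P'(\Gamma)\Phi_V$. Compression shock $S(\Gamma_l)$: for $\Gamma_l\in(-1,0)$ with $\Gamma_lP(\Gamma_l)>0$, put $V_0=\sqrt{\Gamma_lP(\Gamma_l)}$ and $\sigma=-V_0/\Gamma_l>0$; $S(\Gamma_l)$ is the pair of functions on $[0,\infty)^2$ given by $(V,\Gamma)(X,t)=(-V_0,0)$ for $X>\sigma t$ and $(V,\Gamma)(X,t)=(0,\Gamma_l)$ for $X<\sigma t$. For $\Gamma_l=0$, $S(0)$ is the trivial solution $(V,\Gamma)=(0,0)$. (Under the hypotheses, $\Gamma_lP(\Gamma_l)>0$ for all $\Gamma_l<0$ close to $0$.) Entropy condition corresponding to $(\Phi,\Psi)$: for every nonnegative $\varphi\in C_0^\infty((0,\infty)\times(0,\infty))$, $$\int_0^\infty\int_0^\infty\big[\Phi(V,\Gamma)\varphi_t(X,t)+\Psi(V,\Gamma)\varphi_X(X,t)\big]\,dX\,dt\ge0.$$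 *)

theory Defs
  imports "HOL-Analysis.Analysis"
begin

(* C^k regularity on an open set S: all iterated partial derivatives along the
   standard basis up to order k exist and are continuous on S.  On the reals the basis is {1},
   so this is ordinary k-fold continuous differentiability. *)
primrec Ck_on :: "nat \<Rightarrow> ('a::euclidean_space \<Rightarrow> real) \<Rightarrow> 'a set \<Rightarrow> bool" where
  "Ck_on 0 f S \<longleftrightarrow> continuous_on S f"
| "Ck_on (Suc k) f S \<longleftrightarrow>
     (\<forall>x\<in>S. f differentiable (at x)) \<and>
     (\<forall>b\<in>Basis. Ck_on k (\<lambda>x. frechet_derivative f (at x) b) S)"

definition strictly_convex_on :: "'a::real_vector set \<Rightarrow> ('a \<Rightarrow> real) \<Rightarrow> bool" where
  "strictly_convex_on S f \<longleftrightarrow> convex S \<and>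
     (\<forall>x\<in>S. \<forall>y\<in>S. \<forall>u>0. \<forall>v>0. x \<noteq> y \<and> u + v = 1 \<longrightarrow>
        f (u *\<^sub>R x + v *\<^sub>R y) < u * f x + v * f y)"

(* States are pairs (V, \<Gamma>). *)
definition state_space :: "(real \<times> real) set" where
  "state_space = UNIV \<times> {-1<..}"

definition entropy_pair ::
  "(real \<Rightarrow> real) \<Rightarrow> (real \<times> real \<Rightarrow> real) \<Rightarrow> (real \<times> real \<Rightarrow> real) \<Rightarrow> bool" where
  "entropy_pair P \<Phi> \<Psi> \<longleftrightarrow>
     Ck_on 2 \<Phi> state_space \<and> Ck_on 2 \<Psi> state_space \<and>
     convex_on state_space \<Phi> \<and>
     (\<forall>(V, \<Gamma>)\<in>state_space.
        deriv (\<lambda>v. \<Psi> (v, \<Gamma>)) V = - deriv (\<lambda>g. \<Phi> (V, g)) \<Gamma> \<and>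
        deriv (\<lambda>g. \<Psi> (V, g)) \<Gamma> = - deriv P \<Gamma> * deriv (\<lambda>v. \<Phi> (v, \<Gamma>)) V)"

(* The left strains \<Gamma>l for which the compression shock is defined.  Needed because
   sqrt and division are total: without it, compression_shock has no meaning. *)
definition compression_shock_defined :: "(real \<Rightarrow> real) \<Rightarrow> real \<Rightarrow> bool" where
  "compression_shock_defined P \<Gamma>l \<longleftrightarrow>
     \<Gamma>l = 0 \<or> (-1 < \<Gamma>l \<and> \<Gamma>l < 0 \<and> 0 < \<Gamma>l * P \<Gamma>l)"

(* Maps (X, t) to (V, \<Gamma>).  The value on the null set X = \<sigma> * t is immaterial; it is set to
   the left state. *)
definition compression_shock :: "(real \<Rightarrow> real) \<Rightarrow> real \<Rightarrow> real \<times> real \<Rightarrow> real \<times> real" where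
  "compression_shock P \<Gamma>l = (\<lambda>(X, t).
     let V0 = sqrt (\<Gamma>l * P \<Gamma>l); \<sigma> = - V0 / \<Gamma>l
     in if \<Gamma>l = 0 then (0, 0) else if X > \<sigma> * t then (- V0, 0) else (0, \<Gamma>l))"

(* Nonnegative functions in C_0^\<infinity>((0,\<infinity>) \<times> (0,\<infinity>)), extended by zero to the plane;
   arguments are (X, t). *)
definition test_function :: "(real \<times> real \<Rightarrow> real) \<Rightarrow> bool" where
  "test_function \<phi> \<longleftrightarrow>
     (\<forall>k. Ck_on k \<phi> UNIV) \<and> (\<forall>z. 0 \<le> \<phi> z) \<and>
     compact (closure {z. \<phi> z \<noteq> 0}) \<and> closure {z. \<phi> z \<noteq> 0} \<subseteq> {0<..} \<times> {0<..}"

(* For piecewise constant U such as compression_shock, the integrands are bounded, measurable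
   and compactly supported, so the Lebesgue integrals are proper ones (never the default 0). *)
definition entropy_condition ::
  "(real \<times> real \<Rightarrow> real) \<Rightarrow> (real \<times> real \<Rightarrow> real) \<Rightarrow> (real \<times> real \<Rightarrow> real \<times> real) \<Rightarrow> bool" where
  "entropy_condition \<Phi> \<Psi> U \<longleftrightarrow>
     (\<forall>\<phi>. test_function \<phi> \<longrightarrow>
        0 \<le> (LINT t:{0<..}|lborel. LINT X:{0<..}|lborel.
               \<Phi> (U (X, t)) * deriv (\<lambda>s. \<phi> (X, s)) t +
               \<Psi> (U (X, t)) * deriv (\<lambda>x. \<phi> (x, t)) X))"

end

theory Submission
  imports Defs
begin

text \<open>
  Fix the left state \<^term>\<open>(0, a)\<close> and move the right state \<open>u(g)\<close> along the Hugoniot curve through it,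
  with shock speed \<open>\<sigma>(g)\<close>. The derivative of the entropy production
  \<open>\<sigma> (\<Phi>(u) - \<Phi>(0, a)) - (\<Psi>(u) - \<Psi>(0, a))\<close> along this curve is \<open>- \<sigma>'\<close> times the relative entropy
  \<open>\<Phi>(0, a) - \<Phi>(u) - D\<Phi>(u) ((0, a) - u)\<close>. The latter is nonnegative as \<open>\<Phi>\<close> is convex, and \<open>\<sigma>\<close>
  decreases where \<open>P\<close> is concave, so the production, which vanishes as \<open>g\<close> tends to \<open>a\<close>, is
  nonnegative. By Fubini and the fundamental theorem of calculus, the integral in the entropy
  condition is the production at \<open>g = 0\<close> times the integral of the test function along the shock.
\<close>

section \<open>Frechet derivatives, ordinary derivatives and partial derivatives\<close>

lemma frechet_derivative_eq_deriv:
  fixes f :: "real \<Rightarrow> real"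
  assumes "f differentiable (at x)"
  shows "frechet_derivative f (at x) 1 = deriv f x"
proof -
  have f': "(f has_derivative frechet_derivative f (at x)) (at x)"
    using assms by (simp add: frechet_derivative_works)
  then interpret bounded_linear "frechet_derivative f (at x)"
    by (rule has_derivative_bounded_linear)
  have "(f has_real_derivative frechet_derivative f (at x) 1) (at x)"
    using f' by (rule has_derivative_imp_has_field_derivative) (simp flip: scaleR[of _ 1, simplified])
  then show ?thesis
    by (simp add: DERIV_imp_deriv)
qed

text \<open>\<open>Ck_on\<close> iterates \<open>\<lambda>x. frechet_derivative f (at x) 1\<close>,
  which is known to equal \<open>deriv f\<close> only at points of \<open>S\<close>. As
  \<open>S\<close> is open, the agreement carries over to the next derivative.\<close>

lemma Ck_on_2_real:
  fixes f :: "real \<Rightarrow> real"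
  assumes "Ck_on 2 f S" "open S"
  shows "\<And>x. x \<in> S \<Longrightarrow> (deriv f has_real_derivative deriv (deriv f) x) (at x)"
    and "continuous_on S (deriv (deriv f))"
proof -
  define g where "g = (\<lambda>x. frechet_derivative f (at x) 1)"
  have f: "\<forall>x\<in>S. f differentiable (at x)" and g: "\<forall>x\<in>S. g differentiable (at x)"
    and cont: "continuous_on S (\<lambda>x. frechet_derivative g (at x) 1)"
    using assms(1) by (auto simp: numeral_2_eq_2 g_def)
  have eq: "g x = deriv f x" if "x \<in> S" for x
    using f that by (simp add: g_def frechet_derivative_eq_deriv)
  have der: "(deriv f has_real_derivative deriv g x) (at x)" if x: "x \<in> S" for x
  proof -
    have "(g has_real_derivative deriv g x) (at x)"
      using g x by (simp add: DERIV_deriv_iff_real_differentiable)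
    then show ?thesis
      using eq has_field_derivative_transform_within_open[OF _ assms(2) x] by blast
  qed
  then show "(deriv f has_real_derivative deriv (deriv f) x) (at x)" if "x \<in> S" for x
    using that by (metis DERIV_imp_deriv)
  have "deriv (deriv f) x = frechet_derivative g (at x) 1" if "x \<in> S" for x
    using der[OF that] g that by (simp add: DERIV_imp_deriv frechet_derivative_eq_deriv)
  then show "continuous_on S (deriv (deriv f))"
    using cont by (simp cong: continuous_on_cong)
qed

text \<open>Links the partial derivatives written with \<open>deriv\<close> in
  \<open>entropy_pair\<close> and \<open>entropy_condition\<close> to the full derivative, which the
  chain rule along a curve of states uses.\<close>

lemma partial_derivatives:
  fixes f :: "real \<times> real \<Rightarrow> real"
  assumes "f differentiable (at (x, y))"
  defines "f' \<equiv> frechet_derivative f (at (x, y))"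
  shows "((\<lambda>s. f (s, y)) has_real_derivative f' (1, 0)) (at x)"
    and "((\<lambda>s. f (x, s)) has_real_derivative f' (0, 1)) (at y)"
    and "f' (u, v) = u * f' (1, 0) + v * f' (0, 1)"
proof -
  have f': "(f has_derivative f') (at (x, y))"
    unfolding f'_def using assms(1) by (simp add: frechet_derivative_works)
  interpret bounded_linear f' using f' by (rule has_derivative_bounded_linear)
  have lin: "f' (u, v) = u * f' (1, 0) + v * f' (0, 1)" for u v
  proof -
    have "f' (u, v) = f' (u *\<^sub>R (1, 0) + v *\<^sub>R (0, 1))" by simp
    also have "\<dots> = u *\<^sub>R f' (1, 0) + v *\<^sub>R f' (0, 1)" by (simp only: add scaleR)
    finally show ?thesis by simp
  qed
  show "f' (u, v) = u * f' (1, 0) + v * f' (0, 1)" by (rule lin)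
  have "((\<lambda>s. (s, y)) has_derivative (\<lambda>h. (h, 0))) (at x)"
    by (auto intro!: derivative_eq_intros)
  then have "((\<lambda>s. f (s, y)) has_derivative (\<lambda>h. f' (h, 0))) (at x)"
    by (rule has_derivative_compose) (use f' in simp)
  then show "((\<lambda>s. f (s, y)) has_real_derivative f' (1, 0)) (at x)"
    by (rule has_derivative_imp_has_field_derivative) (subst lin, simp)
  have "((\<lambda>s. (x, s)) has_derivative (\<lambda>h. (0, h))) (at y)"
    by (auto intro!: derivative_eq_intros)
  then have "((\<lambda>s. f (x, s)) has_derivative (\<lambda>h. f' (0, h))) (at y)"
    by (rule has_derivative_compose) (use f' in simp)
  then show "((\<lambda>s. f (x, s)) has_real_derivative f' (0, 1)) (at y)"
    by (rule has_derivative_imp_has_field_derivative) (subst lin, simp)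
qed

section \<open>Convexity and tangent planes\<close>

text \<open>Restriction to the line \<open>l\<close> through \<open>x\<close> and \<open>y\<close>
  reduces this to the one-dimensional tangent inequality between the parameters 0 and 1. Openness of
  \<open>S\<close> makes 0 an interior parameter.\<close>

lemma convex_on_above_tangent_plane:
  fixes f :: "'a::real_normed_vector \<Rightarrow> real"
  assumes "convex_on S f" "open S" "x \<in> S" "y \<in> S" "(f has_derivative f') (at x)"
  shows "f x + f' (y - x) \<le> f y"
proof -
  define l where "l = (\<lambda>t::real. x + t *\<^sub>R (y - x))"
  define T where "T = l -` S"
  have S: "convex S" using assms(1) convex_on_imp_convex by blast
  have l: "l (u * s + v * t) = u *\<^sub>R l s + v *\<^sub>R l t" if "u + v = 1" for u v s t
  proof -
    have "u *\<^sub>R x + v *\<^sub>R x = x" using that by (metis scaleR_add_left scaleR_one)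
    then show ?thesis by (simp add: l_def algebra_simps)
  qed
  have "continuous_on UNIV l" unfolding l_def by (intro continuous_intros)
  then have open_T: "open T" unfolding T_def using assms(2) by (simp add: open_vimage)
  have convex_T: "convex T"
    unfolding convex_def T_def using S by (auto simp: l convex_def)
  have convex: "convex_on T (f \<circ> l)"
    using convex_T assms(1) unfolding convex_on_def T_def by (auto simp: l)
  interpret bounded_linear f' using assms(5) by (rule has_derivative_bounded_linear)
  have "(l has_derivative (\<lambda>t. t *\<^sub>R (y - x))) (at 0)"
    unfolding l_def by (auto intro!: derivative_eq_intros)
  then have "(f \<circ> l has_derivative (\<lambda>t. f' (t *\<^sub>R (y - x)))) (at 0)"
    unfolding comp_def by (rule has_derivative_compose) (use assms(5) in \<open>simp add: l_def\<close>)
  then have "(f \<circ> l has_real_derivative f' (y - x)) (at 0)"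
    by (rule has_derivative_imp_has_field_derivative) (simp add: scaleR)
  then have "(f \<circ> l has_real_derivative f' (y - x)) (at 0 within T)"
    by (rule has_field_derivative_at_within)
  moreover have "0 \<in> interior T" "1 \<in> T"
    using assms(3,4) open_T by (simp_all add: interior_open T_def l_def)
  ultimately have "(f \<circ> l) 1 - (f \<circ> l) 0 \<ge> f' (y - x) * (1 - 0)"
    using convex convex_T convex_on_imp_above_tangent convex_connected by blast
  then show ?thesis by (simp add: l_def)
qed

section \<open>Integrals against a weight with one jump\<close>

text \<open>As \<open>F\<close> vanishes far out, the fundamental theorem of calculus leaves only
  its value at the jump \<open>c\<close>. The first form serves slices of a shock at fixed time, the
  second slices at fixed position, where the two sides occur in reverse order.\<close>

lemma integral_deriv_compact_support:
  fixes F f :: "real \<Rightarrow> real"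
  assumes F: "\<And>x. (F has_real_derivative f x) (at x)" and f: "continuous_on UNIV f"
    and zero: "\<And>x. b < \<bar>x\<bar> \<Longrightarrow> F x = 0" "\<And>x. b < \<bar>x\<bar> \<Longrightarrow> f x = 0"
  shows "has_bochner_integral lborel (\<lambda>x. (if c < x then r else l) * f x) ((l - r) * F c)"
    and "has_bochner_integral lborel (\<lambda>x. (if x < c then r else l) * f x) ((r - l) * F c)"
proof -
  \<comment> \<open>The summand 1 puts both endpoints strictly beyond \<open>b\<close>, where
    \<open>F\<close> vanishes, and \<open>c\<close> strictly between them.\<close>
  define B where "B = max b \<bar>c\<bar> + 1"
  have B: "-B \<le> c" "c \<le> B" "-B \<le> B" and F_B: "F (-B) = 0" "F B = 0"
    unfolding B_def by (auto intro!: zero(1))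
  have f_0: "f x = 0" if "\<not> \<bar>x\<bar> \<le> B" for x
    using that by (intro zero) (auto simp: B_def)
  have f': "isCont f x" for x
    using f by (simp add: continuous_on_eq_continuous_at)
  \<comment> \<open>The weight is the constant \<open>r\<close> plus a correction
    \<open>l - r\<close> up to \<open>c\<close>. The closed interval gives the value
    \<open>l\<close> at \<open>c\<close> itself, in accordance with the strict test
    \<open>c < x\<close>.\<close>
  have "has_bochner_integral lborel (\<lambda>x. r * (f x * indicator {-B..B} x) + (l - r) * (f x * indicator {-B..c} x))
     (r * (F B - F (-B)) + (l - r) * (F c - F (-B)))"
    by (intro has_bochner_integral_add has_bochner_integral_mult_right has_bochner_integral_FTC_Icc_real F f' B)
  moreover have "(\<lambda>x. r * (f x * indicator {-B..B} x) + (l - r) * (f x * indicator {-B..c} x))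
     = (\<lambda>x. (if c < x then r else l) * f x)"
    using B f_0 by (fastforce simp: indicator_def algebra_simps)
  ultimately show "has_bochner_integral lborel (\<lambda>x. (if c < x then r else l) * f x) ((l - r) * F c)"
    by (simp add: F_B)
  have "has_bochner_integral lborel (\<lambda>x. r * (f x * indicator {-B..B} x) + (l - r) * (f x * indicator {c..B} x))
     (r * (F B - F (-B)) + (l - r) * (F B - F c))"
    by (intro has_bochner_integral_add has_bochner_integral_mult_right has_bochner_integral_FTC_Icc_real F f' B)
  moreover have "(\<lambda>x. r * (f x * indicator {-B..B} x) + (l - r) * (f x * indicator {c..B} x))
     = (\<lambda>x. (if x < c then r else l) * f x)"
    using B f_0 by (fastforce simp: indicator_def algebra_simps)
  ultimately show "has_bochner_integral lborel (\<lambda>x. (if x < c then r else l) * f x) ((r - l) * F c)"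
    by (simp add: F_B algebra_simps)
qed

lemma integrable_two_valued_times_compact_support:
  fixes g :: "'a::euclidean_space \<Rightarrow> real"
  assumes g: "continuous_on UNIV g" "compact K" "\<And>z. z \<notin> K \<Longrightarrow> g z = 0" and A: "A \<in> sets borel"
  shows "integrable lborel (\<lambda>z. (if z \<in> A then r else l) * g z)"
proof -
  have "integrable lborel (\<lambda>z. indicator K z *\<^sub>R g z)"
    using g by (intro borel_integrable_compact continuous_on_subset[OF g(1)]) auto
  also have "(\<lambda>z. indicator K z *\<^sub>R g z) = g"
    using g(3) by (fastforce simp: indicator_def)
  finally have int: "integrable lborel g" .
  have "integrable lborel (\<lambda>z. l * g z + (r - l) * (indicator A z *\<^sub>R g z))"
    using A int by (intro Bochner_Integration.integrable_add integrable_mult_right integrable_mult_indicator) auto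
  also have "(\<lambda>z. l * g z + (r - l) * (indicator A z *\<^sub>R g z)) = (\<lambda>z. (if z \<in> A then r else l) * g z)"
    by (auto simp: indicator_def algebra_simps)
  finally show ?thesis .
qed

section \<open>Entropy production along the Hugoniot curve\<close>

text \<open>The formulas for \<open>\<sigma>\<close> and \<open>u\<close> solve the Rankine-Hugoniot
  conditions for a jump from \<open>(0, a)\<close> to strain \<open>g\<close>: speed times the jump
  of V is minus the jump of P, and speed times the jump of \<Gamma> is minus the jump of V.\<close>

lemma entropy_production_nonneg:
  fixes P P' :: "real \<Rightarrow> real" and \<Phi> \<Psi> :: "real \<times> real \<Rightarrow> real"
  assumes a: "-1 < a" "a < b"
    and P: "\<And>g. g \<in> {a..b} \<Longrightarrow> (P has_real_derivative P' g) (at g)"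
    and P'_pos: "\<And>g. g \<in> {a..b} \<Longrightarrow> 0 < P' g"
    and P'_anti: "antimono_on {a..b} P'"
    and \<Phi>: "\<And>z. z \<in> state_space \<Longrightarrow> \<Phi> differentiable (at z)"
    and \<Psi>: "\<And>z. z \<in> state_space \<Longrightarrow> \<Psi> differentiable (at z)"
    and convex: "convex_on state_space \<Phi>"
    and compat_V: "\<And>v g. g \<in> {a..b} \<Longrightarrow>
      frechet_derivative \<Psi> (at (v, g)) (1, 0) = - frechet_derivative \<Phi> (at (v, g)) (0, 1)"
    and compat_\<Gamma>: "\<And>v g. g \<in> {a..b} \<Longrightarrow>
      frechet_derivative \<Psi> (at (v, g)) (0, 1) = - P' g * frechet_derivative \<Phi> (at (v, g)) (1, 0)"
  defines "\<sigma> \<equiv> \<lambda>g. sqrt ((P g - P a) / (g - a))"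
  defines "u \<equiv> \<lambda>g. (- \<sigma> g * (g - a), g)"
  shows "\<Psi> (u b) - \<Psi> (0, a) \<le> \<sigma> b * (\<Phi> (u b) - \<Phi> (0, a))"
proof -
  define D where "D = (\<lambda>g. \<sigma> g * (\<Phi> (u g) - \<Phi> (0, a)) - (\<Psi> (u g) - \<Psi> (0, a)))"
  have state: "(v, g) \<in> state_space" if "a \<le> g" for v g
    using that a by (simp add: state_space_def)
  have open_state: "open (state_space)"
    unfolding state_space_def by (intro open_Times) auto
  \<comment> \<open>The point \<open>a\<close> is excluded because the quotient in
    \<open>\<sigma>\<close> degenerates there; a limit from the right replaces it below.\<close>
  have DERIV_D: "\<exists>d\<ge>0. (D has_real_derivative d) (at g)" if g: "a < g" "g \<le> b" for g
  proof -
    \<comment> \<open>The chord slope \<open>q\<close>, the squared speed, is a value of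
      \<open>P'\<close> to the left of \<open>g\<close>. Hence it is positive and at least
      \<open>P' g\<close>, which makes the speed nonincreasing.\<close>
    obtain \<xi> where \<xi>: "a < \<xi>" "\<xi> < g" "P g - P a = (g - a) * P' \<xi>"
      using MVT2[of a g P P'] P g by fastforce
    define q q' where "q = (P g - P a) / (g - a)" and "q' = (P' g - q) / (g - a)"
    have q: "q = P' \<xi>" using \<xi> g by (simp add: q_def)
    then have "0 < q" using P'_pos \<xi> g by simp
    have "P' g \<le> q"
      unfolding q using P'_anti \<xi> g by (auto simp: monotone_on_def)
    then have "q' \<le> 0" using g by (simp add: q'_def divide_nonpos_pos)
    define s where "s = q' / (2 * sqrt q)"
    have "s \<le> 0" using \<open>q' \<le> 0\<close> \<open>0 < q\<close> by (simp add: s_def divide_nonpos_pos)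
    have "((\<lambda>g. (P g - P a) / (g - a)) has_real_derivative q') (at g)"
      using g by (auto intro!: derivative_eq_intros P simp: q'_def q_def field_simps)
    moreover have "(sqrt has_real_derivative inverse (sqrt q) / 2) (at ((P g - P a) / (g - a)))"
      unfolding q_def[symmetric] using \<open>0 < q\<close> by (rule DERIV_real_sqrt)
    ultimately have "(\<sigma> has_real_derivative inverse (sqrt q) / 2 * q') (at g)"
      unfolding \<sigma>_def by (intro DERIV_chain2[of sqrt])
    then have \<sigma>: "(\<sigma> has_real_derivative s) (at g)"
      by (simp add: s_def field_simps)
    have \<sigma>_g: "\<sigma> g = sqrt q" by (simp add: \<sigma>_def q_def)
    have \<sigma>\<sigma>: "\<sigma> g * \<sigma> g = q" using \<open>0 < q\<close> by (simp add: \<sigma>_g)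
    \<comment> \<open>This is the derivative of the jump relation
      \<open>P g - P a = \<sigma> g * \<sigma> g * (g - a)\<close>.\<close>
    have P'_g: "P' g = 2 * \<sigma> g * s * (g - a) + \<sigma> g * \<sigma> g"
      unfolding \<sigma>\<sigma> using g \<open>0 < q\<close> by (simp add: \<sigma>_g s_def q'_def field_simps)
    define w where "w = - s * (g - a) - \<sigma> g"
    have u: "(u has_vector_derivative (w, 1)) (at g)"
      unfolding u_def w_def
      by (rule has_vector_derivative_Pair)
         (auto intro!: derivative_eq_intros \<sigma> simp: has_real_derivative_iff_has_vector_derivative[symmetric])
    define \<Phi>' \<Psi>' where "\<Phi>' = frechet_derivative \<Phi> (at (u g))" and "\<Psi>' = frechet_derivative \<Psi> (at (u g))"
    have u_g: "u g \<in> state_space" using state g by (simp add: u_def)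
    have \<Phi>': "(\<Phi> has_derivative \<Phi>') (at (u g))" and \<Psi>': "(\<Psi> has_derivative \<Psi>') (at (u g))"
      unfolding \<Phi>'_def \<Psi>'_def using \<Phi>[OF u_g] \<Psi>[OF u_g] by (auto simp: frechet_derivative_works)
    have lin: "\<Phi>' (x, y) = x * \<Phi>' (1, 0) + y * \<Phi>' (0, 1)"
              "\<Psi>' (x, y) = x * \<Psi>' (1, 0) + y * \<Psi>' (0, 1)" for x y
      using partial_derivatives(3)[OF \<Phi>[OF u_g[unfolded u_def]]]
        partial_derivatives(3)[OF \<Psi>[OF u_g[unfolded u_def]]]
      unfolding \<Phi>'_def \<Psi>'_def u_def by blast+
    have compat: "\<Psi>' (1, 0) = - \<Phi>' (0, 1)" "\<Psi>' (0, 1) = - P' g * \<Phi>' (1, 0)"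
      unfolding \<Phi>'_def \<Psi>'_def u_def using g by (auto simp: compat_V compat_\<Gamma>)
    have "((\<lambda>g. \<Phi> (u g)) has_real_derivative \<Phi>' (w, 1)) (at g)"
      using vector_derivative_diff_chain_within[of u "(w, 1)" g UNIV \<Phi> \<Phi>'] u \<Phi>'
      by (simp add: has_real_derivative_iff_has_vector_derivative comp_def has_derivative_at_withinI)
    moreover have "((\<lambda>g. \<Psi> (u g)) has_real_derivative \<Psi>' (w, 1)) (at g)"
      using vector_derivative_diff_chain_within[of u "(w, 1)" g UNIV \<Psi> \<Psi>'] u \<Psi>'
      by (simp add: has_real_derivative_iff_has_vector_derivative comp_def has_derivative_at_withinI)
    ultimately have "(D has_real_derivative s * (\<Phi> (u g) - \<Phi> (0, a)) + \<sigma> g * \<Phi>' (w, 1) - \<Psi>' (w, 1)) (at g)"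
      unfolding D_def by (auto intro!: derivative_eq_intros \<sigma>)
    moreover have u_diff: "\<Phi>' ((0, a) - u g) = \<sigma> g * (g - a) * \<Phi>' (1, 0) + (a - g) * \<Phi>' (0, 1)"
      using lin(1)[of "\<sigma> g * (g - a)" "a - g"] by (simp add: u_def)
    \<comment> \<open>After substitution the coefficient of \<open>\<Phi>' (1, 0)\<close> collapses
      to \<open>s * \<sigma> g * (g - a)\<close> and that of \<open>\<Phi>' (0, 1)\<close> to
      \<open>- s * (g - a)\<close>. Together they form \<open>s\<close> times the derivative in
      direction \<open>(0, a) - u g\<close>.\<close>
    have "s * (\<Phi> (u g) - \<Phi> (0, a)) + \<sigma> g * \<Phi>' (w, 1) - \<Psi>' (w, 1)
      = - s * (\<Phi> (0, a) - \<Phi> (u g) - \<Phi>' ((0, a) - u g))"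
      unfolding u_diff lin[of w] compat P'_g unfolding w_def by (simp add: algebra_simps)
    ultimately have "(D has_real_derivative - s * (\<Phi> (0, a) - \<Phi> (u g) - \<Phi>' ((0, a) - u g))) (at g)"
      by (simp only:)
    moreover have "\<Phi> (u g) + \<Phi>' ((0, a) - u g) \<le> \<Phi> (0, a)"
      using convex_on_above_tangent_plane[OF convex open_state u_g _ \<Phi>'] state by simp
    ultimately show ?thesis using \<open>s \<le> 0\<close> by (intro exI conjI) (auto intro: mult_nonpos_nonneg)
  qed
  have "(\<lambda>g. (P g - P a) / (g - a)) \<midarrow>a\<rightarrow> P' a"
    using P[of a] a by (simp add: has_field_derivative_iff)
  \<comment> \<open>A finite limit of the speed suffices: it multiplies a difference of
    \<open>\<Phi>\<close> that tends to 0.\<close>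
  then have \<sigma>: "(\<sigma> \<longlongrightarrow> sqrt (P' a)) (at_right a)"
    unfolding \<sigma>_def by (intro tendsto_intros) (rule tendsto_mono[OF at_le], auto)
  then have "(u \<longlongrightarrow> (- sqrt (P' a) * (a - a), a)) (at_right a)"
    unfolding u_def by (intro tendsto_intros)
  then have u: "(u \<longlongrightarrow> (0, a)) (at_right a)" by simp
  have "isCont \<Phi> (0, a)" "isCont \<Psi> (0, a)"
    using \<Phi> \<Psi> state by (auto intro: differentiable_imp_continuous_within)
  then have "(D \<longlongrightarrow> sqrt (P' a) * (\<Phi> (0, a) - \<Phi> (0, a)) - (\<Psi> (0, a) - \<Psi> (0, a))) (at_right a)"
    unfolding D_def by (intro tendsto_intros \<sigma> isCont_tendsto_compose[OF _ u])
  then have "(D \<longlongrightarrow> 0) (at_right a)" by simp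
  moreover have "\<forall>\<^sub>F g in at_right a. D g \<le> D b"
    using eventually_at_right_less[of a] eventually_at_right_real[OF a(2)]
  proof eventually_elim
    case (elim g)
    then have "g \<le> b" by simp
    then show ?case
    proof (rule DERIV_nonneg_imp_nondecreasing)
      fix x assume "g \<le> x" "x \<le> b"
      with elim DERIV_D[of x] show "\<exists>d. (D has_real_derivative d) (at x) \<and> 0 \<le> d"
        by auto
    qed
  qed
  ultimately have "0 \<le> D b"
    by (rule tendsto_upperbound) simp
  then show ?thesis by (simp add: D_def)
qed

section \<open>The entropy integral of a single shock\<close>

text \<open>Here \<open>l\<close>, \<open>r\<close> stand for the values of \<Phi> to the left and
  right of the shock line, and \<open>l'\<close>, \<open>r'\<close> for those of \<Psi>. Each
  derivative is integrated in its own variable, so only traces on the line survive; the \<Phi> term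
  first needs the order of integration exchanged.\<close>

lemma entropy_integral_of_shock:
  fixes \<phi> :: "real \<times> real \<Rightarrow> real"
  assumes \<phi>: "test_function \<phi>" and \<sigma>: "0 < \<sigma>"
  shows "(LINT t:{0<..}|lborel. LINT X:{0<..}|lborel.
      (if \<sigma> * t < X then r else l) * deriv (\<lambda>s. \<phi> (X, s)) t +
      (if \<sigma> * t < X then r' else l') * deriv (\<lambda>x. \<phi> (x, t)) X)
    = (\<sigma> * (r - l) - (r' - l')) * (LINT t|lborel. \<phi> (\<sigma> * t, t))"
proof -
  define K where "K = closure {z. \<phi> z \<noteq> 0}"
  have K: "compact K" "K \<subseteq> {0<..} \<times> {0<..}"
    using \<phi> by (auto simp: test_function_def K_def)
  have \<phi>_0: "\<phi> z = 0" if "z \<notin> K" for z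
    using that closure_subset[of "{z. \<phi> z \<noteq> 0}"] by (auto simp: K_def)
  have cont: "continuous_on UNIV \<phi>"
    using \<phi> Ck_on.simps(1) unfolding test_function_def by blast
  have "Ck_on (Suc 0) \<phi> UNIV"
    using \<phi> unfolding test_function_def by blast
  then have diff: "\<phi> differentiable (at z)"
    and cont': "b \<in> Basis \<Longrightarrow> continuous_on UNIV (\<lambda>z. frechet_derivative \<phi> (at z) b)" for z b
    unfolding Ck_on.simps by blast+
  have \<phi>'_0: "frechet_derivative \<phi> (at z) b = 0" if "z \<notin> K" for z b
  proof -
    have "open (- K)" "z \<in> - K" using that by (auto simp: K_def)
    then have "frechet_derivative \<phi> (at z) = frechet_derivative (\<lambda>_. 0) (at z)"
      using \<phi>_0 by (intro frechet_derivative_transform_within_open[OF diff]) auto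
    then show ?thesis by simp
  qed
  define \<phi>X where "\<phi>X X t = frechet_derivative \<phi> (at (X, t)) (1, 0)" for X t
  define \<phi>T where "\<phi>T X t = frechet_derivative \<phi> (at (X, t)) (0, 1)" for X t
  have der_X: "((\<lambda>x. \<phi> (x, t)) has_real_derivative \<phi>X X t) (at X)" for X t
    unfolding \<phi>X_def by (intro partial_derivatives diff)
  have der_T: "((\<lambda>s. \<phi> (X, s)) has_real_derivative \<phi>T X t) (at t)" for X t
    unfolding \<phi>T_def by (intro partial_derivatives diff)
  have cont_T: "continuous_on UNIV (\<lambda>z. \<phi>T (fst z) (snd z))"
    unfolding \<phi>T_def using cont'[of "(0, 1)"] by (simp add: Basis_prod_def)
  have cont_X: "continuous_on UNIV (\<lambda>z. \<phi>X (fst z) (snd z))"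
    unfolding \<phi>X_def using cont'[of "(1, 0)"] by (simp add: Basis_prod_def)
  have cont_X1: "continuous_on UNIV (\<lambda>X. \<phi>X X t)" for t
    by (rule continuous_on_compose2[OF cont_X, of UNIV "\<lambda>X. (X, t)", simplified]) (intro continuous_intros)
  have cont_T1: "continuous_on UNIV (\<lambda>X. \<phi>T X t)" for t
    by (rule continuous_on_compose2[OF cont_T, of UNIV "\<lambda>X. (X, t)", simplified]) (intro continuous_intros)
  have cont_T2: "continuous_on UNIV (\<lambda>t. \<phi>T X t)" for X
    by (rule continuous_on_compose2[OF cont_T, of UNIV "\<lambda>t. (X, t)", simplified]) (intro continuous_intros)
  obtain B where B: "\<And>z. z \<in> K \<Longrightarrow> norm z \<le> B"
    using compact_imp_bounded[OF K(1)] by (auto simp: bounded_iff)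
  have notin_K: "(X, t) \<notin> K" if "B < \<bar>X\<bar> \<or> B < \<bar>t\<bar>" for X t
    using B[of "(X, t)"] norm_fst_le[of X t] norm_snd_le[of t X] that by auto
  define I where "I X t = (if \<sigma> * t < X then r else l) * \<phi>T X t" for X t
  define J where "J X t = (if \<sigma> * t < X then r' else l') * \<phi>X X t" for X t
  have IJ_0: "I X t = 0" "J X t = 0" if "(X, t) \<notin> K" for X t
    using that by (auto simp: I_def J_def \<phi>X_def \<phi>T_def \<phi>'_0)

  have J: "has_bochner_integral lborel (\<lambda>X. J X t) ((l' - r') * \<phi> (\<sigma> * t, t))" for t
    unfolding J_def
    by (intro integral_deriv_compact_support(1)[where b = B] der_X cont_X1)
       (simp_all add: \<phi>_0 \<phi>'_0 \<phi>X_def notin_K)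
  have I_T: "has_bochner_integral lborel (\<lambda>t. I X t) ((r - l) * \<phi> (X, X / \<sigma>))" for X
  proof -
    \<comment> \<open>At a fixed position the shock arrives at time \<open>X / \<sigma>\<close>, and
      the right state is the earlier one.\<close>
    have *: "I X t = (if t < X / \<sigma> then r else l) * \<phi>T X t" for t
      using \<sigma> by (simp add: I_def field_simps)
    then show ?thesis
      unfolding *
      by (intro integral_deriv_compact_support(2)[where b = B] der_T cont_T2)
       (simp_all add: \<phi>_0 \<phi>'_0 \<phi>T_def notin_K)
  qed
  \<comment> \<open>Integrability of each slice in \<open>X\<close> permits splitting the inner
    integral of \<open>I + J\<close>; joint integrability, shown next, permits Fubini.\<close>
  have I_X: "integrable lborel (\<lambda>X. I X t)" for t
  proof -
    have "integrable lborel (\<lambda>X. (if X \<in> {\<sigma> * t<..} then r else l) * \<phi>T X t)"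
      by (intro integrable_two_valued_times_compact_support[where K = "{-B..B}"] cont_T1)
         (auto simp: \<phi>T_def intro!: \<phi>'_0 notin_K)
    then show ?thesis by (simp add: I_def)
  qed
  have "integrable (lborel :: (real \<times> real) measure)
      (\<lambda>z. (if z \<in> {z. \<sigma> * snd z < fst z} then r else l) * \<phi>T (fst z) (snd z))"
    by (intro integrable_two_valued_times_compact_support[where K = K] cont_T K borel_open open_Collect_less)
       (auto simp: \<phi>T_def \<phi>'_0
        intro!: continuous_on_mult continuous_on_fst continuous_on_snd continuous_on_const continuous_on_id)
  then have I: "integrable (lborel \<Otimes>\<^sub>M lborel) (\<lambda>(X, t). I X t)"
    by (simp add: I_def lborel_prod case_prod_unfold)
  have trace: "integrable lborel (\<lambda>t. \<phi> (\<sigma> * t, t))"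
  proof -
    have "continuous_on UNIV (\<lambda>t. \<phi> (\<sigma> * t, t))"
      by (rule continuous_on_compose2[OF cont]) (auto intro!: continuous_intros)
    then have "integrable lborel (\<lambda>t. (if t \<in> UNIV then 1 else 0) * \<phi> (\<sigma> * t, t))"
      by (rule integrable_two_valued_times_compact_support[where K = "{-B..B}"])
         (auto intro!: \<phi>_0 notin_K)
    then show ?thesis by simp
  qed

  \<comment> \<open>The support lies in the open quadrant, so both half-line integrals extend to the
    whole line.\<close>
  have set_integral: "(LINT x:{0<..}|lborel. f x) = (LINT x|lborel. f x)"
    if "\<And>x. x \<le> 0 \<Longrightarrow> f x = 0" for f :: "real \<Rightarrow> real"
    using that by (auto simp: set_lebesgue_integral_def indicator_def intro!: Bochner_Integration.integral_cong)
  have "(LINT t:{0<..}|lborel. LINT X:{0<..}|lborel.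
      (if \<sigma> * t < X then r else l) * deriv (\<lambda>s. \<phi> (X, s)) t +
      (if \<sigma> * t < X then r' else l') * deriv (\<lambda>x. \<phi> (x, t)) X)
    = (LINT t:{0<..}|lborel. LINT X:{0<..}|lborel. I X t + J X t)"
    by (simp add: I_def J_def DERIV_imp_deriv[OF der_X] DERIV_imp_deriv[OF der_T])
  also have "\<dots> = (LINT t:{0<..}|lborel. LINT X|lborel. I X t + J X t)"
  proof -
    have "(X, t) \<notin> K" if "X \<le> 0" for X t using K(2) that by force
    then show ?thesis by (subst set_integral) (auto simp: IJ_0)
  qed
  also have "\<dots> = (LINT t|lborel. LINT X|lborel. I X t + J X t)"
  proof -
    have "(X, t) \<notin> K" if "t \<le> 0" for X t using K(2) that by force
    then show ?thesis by (subst set_integral) (auto simp: IJ_0)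
  qed
  also have "\<dots> = (LINT t|lborel. (LINT X|lborel. I X t) + (l' - r') * \<phi> (\<sigma> * t, t))"
    using J I_X by (simp add: has_bochner_integral_iff)
  also have "\<dots> = (LINT t|lborel. LINT X|lborel. I X t) + (l' - r') * (LINT t|lborel. \<phi> (\<sigma> * t, t))"
    using lborel_pair.integrable_snd[OF I] trace by simp
  also have "(LINT t|lborel. LINT X|lborel. I X t) = (LINT X|lborel. LINT t|lborel. I X t)"
    by (rule lborel_pair.Fubini_integral[OF I])
  also have "\<dots> = (r - l) * (LINT X|lborel. \<phi> (X, X / \<sigma>))"
    using I_T by (simp add: has_bochner_integral_iff)
  \<comment> \<open>The substitution \<open>X = \<sigma> * t\<close> contributes the factor
    \<open>\<sigma>\<close> in front of the jump of \<Phi>.\<close>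
  also have "(LINT X|lborel. \<phi> (X, X / \<sigma>)) = \<sigma> * (LINT t|lborel. \<phi> (\<sigma> * t, t))"
    using lborel_integral_real_affine[of \<sigma> "\<lambda>X. \<phi> (X, X / \<sigma>)" 0] \<sigma> by simp
  finally show ?thesis by (simp add: algebra_simps)
qed

section \<open>Small compression shocks\<close>

theorem theorem2:
  fixes P :: "real \<Rightarrow> real" and \<Phi> \<Psi> :: "real \<times> real \<Rightarrow> real"
  assumes "Ck_on 2 P {-1<..}"
    and "P 0 = 0" and "deriv P 0 > 0" and "deriv (deriv P) 0 < 0"
    and "entropy_pair P \<Phi> \<Psi>"
    and "strictly_convex_on state_space \<Phi>"
  shows "\<exists>\<delta>>0. \<forall>\<Gamma>l\<in>{-\<delta><..0}.
           compression_shock_defined P \<Gamma>l \<and>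
           entropy_condition \<Phi> \<Psi> (compression_shock P \<Gamma>l)"
proof -
  have P: "(P has_real_derivative deriv P g) (at g)" if "-1 < g" for g
    using assms(1) that by (auto simp: numeral_2_eq_2 DERIV_deriv_iff_real_differentiable)
  have P': "(deriv P has_real_derivative deriv (deriv P) g) (at g)" if "-1 < g" for g
    using Ck_on_2_real(1)[OF assms(1)] that by simp
  have "isCont (deriv P) 0" "isCont (deriv (deriv P)) 0"
    using P'[of 0] Ck_on_2_real(2)[OF assms(1)]
    by (auto intro: DERIV_isCont simp: continuous_on_eq_continuous_at)
  then have "\<forall>\<^sub>F g in nhds 0. 0 < deriv P g" "\<forall>\<^sub>F g in nhds 0. deriv (deriv P) g < 0"
    using assms(3,4) order_tendstoD unfolding isCont_def tendsto_at_iff_tendsto_nhds by blast+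
  then have "\<forall>\<^sub>F g in nhds 0. 0 < deriv P g \<and> deriv (deriv P) g < 0"
    by (rule eventually_conj)
  then obtain \<epsilon> where \<epsilon>: "0 < \<epsilon>" "\<And>g. \<bar>g\<bar> < \<epsilon> \<Longrightarrow> 0 < deriv P g \<and> deriv (deriv P) g < 0"
    by (auto simp: eventually_nhds_metric)
  \<comment> \<open>The bound \<open>\<epsilon>\<close> keeps P increasing and concave between the
    left strain and 0; the bound 1 keeps that strain above -1.\<close>
  define \<delta> where "\<delta> = min \<epsilon> 1"

  have diff: "\<Phi> differentiable (at z)" "\<Psi> differentiable (at z)" if "z \<in> state_space" for z
    using assms(5) that by (auto simp: entropy_pair_def numeral_2_eq_2)
  have compat:
    "frechet_derivative \<Psi> (at (v, g)) (1, 0) = - frechet_derivative \<Phi> (at (v, g)) (0, 1)"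
    "frechet_derivative \<Psi> (at (v, g)) (0, 1) = - deriv P g * frechet_derivative \<Phi> (at (v, g)) (1, 0)"
    if "-1 < g" for v g
  proof -
    have z: "(v, g) \<in> state_space" using that by (simp add: state_space_def)
    note d = partial_derivatives(1,2)[OF diff(1)[OF z], THEN DERIV_imp_deriv]
      partial_derivatives(1,2)[OF diff(2)[OF z], THEN DERIV_imp_deriv]
    show "frechet_derivative \<Psi> (at (v, g)) (1, 0) = - frechet_derivative \<Phi> (at (v, g)) (0, 1)"
      "frechet_derivative \<Psi> (at (v, g)) (0, 1) = - deriv P g * frechet_derivative \<Phi> (at (v, g)) (1, 0)"
      using assms(5) z unfolding entropy_pair_def by (auto simp flip: d)
  qed

  have "compression_shock_defined P a \<and> entropy_condition \<Phi> \<Psi> (compression_shock P a)"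
    if a: "-\<delta> < a" "a < 0" for a
  proof -
    have "-1 < a" using a by (simp add: \<delta>_def)
    have near: "0 < deriv P g \<and> deriv (deriv P) g < 0" if "a \<le> g" "g \<le> 0" for g
      using a that by (auto simp: \<delta>_def intro!: \<epsilon>(2))
    have "P a < P 0"
    proof (rule DERIV_pos_imp_increasing[OF a(2)])
      fix g assume "a \<le> g" "g \<le> 0"
      then show "\<exists>d. (P has_real_derivative d) (at g) \<and> 0 < d"
        using near[of g] P[of g] \<open>-1 < a\<close> by auto
    qed
    then have P_a: "P a < 0" using assms(2) by simp
    have anti: "antimono_on {a..0} (deriv P)"
    proof (rule monotone_onI)
      fix g h assume gh: "g \<in> {a..0}" "h \<in> {a..0}" "g \<le> h"
      show "deriv P h \<le> deriv P g"
      proof (rule DERIV_nonpos_imp_nonincreasing[OF gh(3)])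
        fix x assume "g \<le> x" "x \<le> h"
        then show "\<exists>d. (deriv P has_real_derivative d) (at x) \<and> d \<le> 0"
          using gh near[of x] P'[of x] \<open>-1 < a\<close> by auto
      qed
    qed
    define \<sigma> where "\<sigma> = sqrt (P a / a)"
    define V where "V = sqrt (a * P a)"
    have \<sigma>: "0 < \<sigma>" using P_a a by (simp add: \<sigma>_def divide_neg_neg)
    \<comment> \<open>As \<open>a\<close> is negative, \<open>sqrt (a\<^sup>2)\<close> is
      \<open>- a\<close>. Thus the speed \<open>- V / a\<close> in \<open>compression_shock\<close>
      is \<open>\<sigma>\<close>.\<close>
    have "a * P a = a\<^sup>2 * (P a / a)" using a by (simp add: power2_eq_square)
    then have "V = sqrt (a\<^sup>2) * sqrt (P a / a)" unfolding V_def by (simp only: real_sqrt_mult)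
    then have V: "V = - a * \<sigma>" using a by (simp add: \<sigma>_def)
    have shock: "compression_shock P a (X, t) = (if \<sigma> * t < X then (- V, 0) else (0, a))" for X t
      using a by (simp add: compression_shock_def Let_def V V_def[symmetric])
    \<comment> \<open>Endpoint \<open>b = 0\<close> of the Hugoniot curve: since
      \<open>P 0 = 0\<close>, the chord slope is \<open>P a / a\<close> and the right state is
      \<open>(- V, 0)\<close>.\<close>
    have "\<Psi> (- V, 0) - \<Psi> (0, a) \<le> \<sigma> * (\<Phi> (- V, 0) - \<Phi> (0, a))"
      using entropy_production_nonneg[of a 0 P "deriv P" \<Phi> \<Psi>,
          OF \<open>-1 < a\<close> a(2) P _ anti diff _ compat] near \<open>-1 < a\<close> assms(2,5)
      by (simp add: entropy_pair_def V \<sigma>_def mult.commute[of a])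
    then have production: "0 \<le> \<sigma> * (\<Phi> (- V, 0) - \<Phi> (0, a)) - (\<Psi> (- V, 0) - \<Psi> (0, a))"
      by simp
    have "entropy_condition \<Phi> \<Psi> (compression_shock P a)"
      unfolding entropy_condition_def shock if_distrib[of \<Phi>] if_distrib[of \<Psi>]
    proof (intro allI impI, subst entropy_integral_of_shock[OF _ \<sigma>])
      fix \<phi> assume \<phi>: "test_function \<phi>"
      then have "0 \<le> \<phi> z" for z unfolding test_function_def by blast
      then show "0 \<le> (\<sigma> * (\<Phi> (- V, 0) - \<Phi> (0, a)) - (\<Psi> (- V, 0) - \<Psi> (0, a))) *
          (LINT t|lborel. \<phi> (\<sigma> * t, t))"
        by (intro mult_nonneg_nonneg production Bochner_Integration.integral_nonneg)
    qed
    then show ?thesis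
      using a P_a \<open>-1 < a\<close> by (simp add: compression_shock_defined_def mult_neg_neg)
  qed
  \<comment> \<open>The trivial solution counts as a shock with equal sides and zero production, so
    any positive speed serves, such as 1.\<close>
  moreover have "entropy_condition \<Phi> \<Psi> (compression_shock P 0)"
    using entropy_integral_of_shock[where \<sigma> = 1 and l = "\<Phi> (0, 0)" and r = "\<Phi> (0, 0)"
        and l' = "\<Psi> (0, 0)" and r' = "\<Psi> (0, 0)"]
    by (simp add: entropy_condition_def compression_shock_def)
  moreover have "compression_shock_defined P 0" by (simp add: compression_shock_defined_def)
  ultimately have "compression_shock_defined P a \<and> entropy_condition \<Phi> \<Psi> (compression_shock P a)"
    if "a \<in> {-\<delta><..0}" for a
    using that by (cases "a = 0") auto
  then show ?thesis
    using \<epsilon>(1) by (intro exI[of _ \<delta>]) (auto simp: \<delta>_def)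
qed

end
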